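(* Let $m,n,I_1,\dots,I_m$ be positive integers. Let $f:\mathbb{R}^n\to\mathbb{R}^n$ be continuous and suppose there exists a constant $\alpha$ such that $(x-y)^{\top}[f(x)-f(y)]\le \alpha (x-y)^{\top}(x-y)$ for all $x,y\in\mathbb{R}^n$. For each $k=1,\dots,m$ let $c_k$ be a constant (the coupling strength of the $k$th order subnetwork) and let $L^{(k)}=[l^{(k)}_{ij}]\in\mathbb{R}^{I_k\times I_k}$ be a symmetric matrix with $l^{(k)}_{ij}\ge 0$ for $i\ne j$ and all row sums equal to zero, with eigenvalues $0=\lambda^{(k)}_1\ge\lambda^{(k)}_2\ge\cdots\ge\lambda^{(k)}_{I_k}$. Consider the $m$th order layered network $$\frac{d x_{i_1,\dots,i_m}(t)}{dt}=f(x_{i_1,\dots,i_m}(t))+\sum_{k=1}^{m}c_k\sum_{j=1}^{I_k}l^{(k)}_{i_k j}\,x_{i_1,\dots,i_{k-1},j,i_{k+1},\dots,i_m}(t),\qquad 1\le i_s\le I_s,\ s=1,\dots,m,$$ with $x_{i_1,\dots,i_m}(t)\in\mathbb{R}^n$. Then the network will realize complete synchronization if $\max_{k=1,\dots,m}\bigl(c_k\lambda^{(k)}_2+\alpha\bigr)<0$.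
   Context: Definition. The network is said to realize complete synchronization if $$\lim_{t\to\infty}\|x_{i_1,\dots,i_m}(t)-x_{j_1,\dots,j_m}(t)\|=0$$ holds for any $1\le i_k,j_k\le I_k$, $k=1,\dots,m$.
   Formalization: The coupling strengths c_k are assumed nonnegative; for negative c_k the claim fails (three-node path, eigenvalues 0,-1,-3, c=-1, f(x)=-2x, alpha=-2). Layers with I_k=1, which have no second eigenvalue, impose no condition. *)

theory Defs
  imports "HOL-Analysis.Analysis" "Jordan_Normal_Form.Char_Poly"
begin

(* All indices start at 0: the layers are k < m, and a node (i_1,...,i_m) is a function i with
   i k < I k for k < m, made undefined outside {..<m} by the extensional product PiE. *)

definition nodes :: "nat \<Rightarrow> (nat \<Rightarrow> nat) \<Rightarrow> (nat \<Rightarrow> nat) set" where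
  "nodes m I = (\<Pi>\<^sub>E k\<in>{..<m}. {..<I k})"

(* The solutions live on the half-line t >= 0, with a one-sided derivative at 0. *)

definition network_solution ::
  "nat \<Rightarrow> (nat \<Rightarrow> nat) \<Rightarrow> (real^'n \<Rightarrow> real^'n) \<Rightarrow> (nat \<Rightarrow> real) \<Rightarrow> (nat \<Rightarrow> real mat) \<Rightarrow>
   ((nat \<Rightarrow> nat) \<Rightarrow> real \<Rightarrow> real^'n) \<Rightarrow> bool" where
  "network_solution m I f c L x \<longleftrightarrow>
    (\<forall>i\<in>nodes m I. \<forall>t\<ge>0.
      (x i has_vector_derivative
        f (x i t) + (\<Sum>k<m. c k *\<^sub>R (\<Sum>j<I k. L k $$ (i k, j) *\<^sub>R x (i(k := j)) t)))
      (at t within {0..}))"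

definition realizes_complete_synchronization ::
  "nat \<Rightarrow> (nat \<Rightarrow> nat) \<Rightarrow> (real^'n \<Rightarrow> real^'n) \<Rightarrow> (nat \<Rightarrow> real) \<Rightarrow> (nat \<Rightarrow> real mat) \<Rightarrow> bool" where
  "realizes_complete_synchronization m I f c L \<longleftrightarrow>
    (\<forall>x. network_solution m I f c L x \<longrightarrow>
      (\<forall>i\<in>nodes m I. \<forall>j\<in>nodes m I. ((\<lambda>t. norm (x i t - x j t)) \<longlongrightarrow> 0) at_top))"

(* The eigenvalues with algebraic multiplicity, in decreasing order. *)

definition eigenvalues_decreasing :: "real mat \<Rightarrow> real list \<Rightarrow> bool" where
  "eigenvalues_decreasing A es \<longleftrightarrow>
    char_poly A = (\<Prod>a\<leftarrow>es. [:- a, 1:]) \<and> sorted_wrt (\<ge>) es"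

end

theory Submission
  imports Defs
begin

text \<open>
  The quantity $W = \sum_{i,j} |x_i - x_j|^2$, summed over pairs of nodes, decays exponentially.
  The coupling of layer $k$ acts on every fibre of that layer separately, where by the
  variational principle it contributes at most $c_k \lambda^{(k)}_2 |x - P_k x|^2$, with $P_k$ the
  averaging over the $k$th index. The Efron--Stein type inequality
  $|x - P_0 \cdots P_{m-1} x|^2 \le \sum_k |x - P_k x|^2$ holds because each $P_k$ is an orthogonal
  projection; the composition of the $P_k$ is constant on the nodes, so the right-hand side controls
  $W$. Hence $W' \le 2 (\alpha + \mu) W$ as soon as $c_k \lambda^{(k)}_2 \le \mu \le 0$ for
  all $k$.
\<close>

section \<open>The quadratic form on centred vectors\<close>

definition quad_form :: "nat \<Rightarrow> (nat \<Rightarrow> nat \<Rightarrow> real) \<Rightarrow> (nat \<Rightarrow> real) \<Rightarrow> real" where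
  "quad_form n a v = (\<Sum>i<n. v i * (\<Sum>j<n. a i j * v j))"

lemma quad_form_scale: "quad_form n a (\<lambda>i. r * v i) = r\<^sup>2 * quad_form n a v"
  by (simp add: quad_form_def sum_distrib_left power2_eq_square mult_ac)

lemma quad_form_add_scaled:
  assumes sym: "\<And>i j. i < n \<Longrightarrow> j < n \<Longrightarrow> a i j = a j i"
  shows "quad_form n a (\<lambda>i. w i + t * h i)
    = quad_form n a w + 2 * t * (\<Sum>i<n. h i * (\<Sum>j<n. a i j * w j)) + t\<^sup>2 * quad_form n a h"
proof -
  have "(\<Sum>i<n. w i * (\<Sum>j<n. a i j * h j)) = (\<Sum>j<n. \<Sum>i<n. w i * (a i j * h j))"
    unfolding sum_distrib_left by (rule sum.swap)
  also have "\<dots> = (\<Sum>i<n. h i * (\<Sum>j<n. a i j * w j))"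
    unfolding sum_distrib_left by (intro sum.cong refl) (auto simp: sym mult_ac)
  finally have swap: "(\<Sum>i<n. w i * (\<Sum>j<n. a i j * h j)) = (\<Sum>i<n. h i * (\<Sum>j<n. a i j * w j))" .
  have "quad_form n a (\<lambda>i. w i + t * h i)
      = (\<Sum>i<n. w i * (\<Sum>j<n. a i j * w j) + t * (w i * (\<Sum>j<n. a i j * h j))
          + t * (h i * (\<Sum>j<n. a i j * w j)) + t\<^sup>2 * (h i * (\<Sum>j<n. a i j * h j)))"
    unfolding quad_form_def
    by (intro sum.cong refl)
      (simp add: sum.distrib sum_distrib_left algebra_simps power2_eq_square)
  also have "\<dots> = quad_form n a w + t * (\<Sum>i<n. w i * (\<Sum>j<n. a i j * h j))
      + t * (\<Sum>i<n. h i * (\<Sum>j<n. a i j * w j)) + t\<^sup>2 * quad_form n a h"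
    by (simp add: sum.distrib sum_distrib_left quad_form_def)
  finally show ?thesis by (simp add: swap)
qed

text \<open>First-order condition at a maximum: for small \<open>t\<close> of the same sign as
  \<open>a\<close>, the linear term would outweigh the quadratic one.\<close>

lemma linear_coeff_zero:
  fixes a b :: real
  assumes "\<And>t. 2 * t * a + t\<^sup>2 * b \<le> 0"
  shows "a = 0"
proof -
  \<comment> \<open>\<open>B\<close> is chosen so that \<open>2 * B + b\<close> is positive; at
    \<open>t = a / B\<close> the expression becomes the square of \<open>a\<close> times a positive
    number.\<close>
  define B where "B = \<bar>b\<bar> + 1"
  have B: "B > 0" "2 * B + b > 0" by (auto simp: B_def)
  have "2 * (a / B) * a + (a / B)\<^sup>2 * b = a\<^sup>2 * (2 * B + b) / B\<^sup>2"
    using B by (simp add: field_simps power2_eq_square)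
  with assms[of "a / B"] have "a\<^sup>2 * (2 * B + b) / B\<^sup>2 \<le> 0" by simp
  then have "a\<^sup>2 * (2 * B + b) \<le> 0"
    using B by (simp add: divide_le_0_iff zero_less_power2)
  then have "a\<^sup>2 \<le> 0"
    using B by (simp add: mult_le_0_iff)
  then show ?thesis by simp
qed

text \<open>Tychonoff's theorem. Vectors of any length \<open>n\<close> live in the one type of real
  sequences, so the entries from index \<open>n\<close> on are pinned to 0 to keep the cube
  compact.\<close>

lemma compact_cube_functions:
  "compact {v :: nat \<Rightarrow> real. \<forall>i. v i \<in> (if i < n then {-1..1} else {0})}"
proof -
  have "compactin (product_topology (\<lambda>_. euclidean) UNIV)
      (Pi\<^sub>E UNIV (\<lambda>i. if i < n then {-1..1::real} else {0}))"
    unfolding compactin_PiE by auto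
  then show ?thesis
    by (simp add: euclidean_product_topology PiE_UNIV_domain Pi_def)
qed

text \<open>Centred vectors of norm one form a compact set, nonempty for \<open>n \<ge> 2\<close>,
  on which the continuous quadratic form attains its maximum. Homogeneity extends the bound to all
  centred vectors.\<close>

lemma exists_max_rayleigh_centred:
  assumes "n \<ge> 2"
  obtains \<mu> w where "(\<Sum>i<n. w i) = 0" "(\<Sum>i<n. (w i)\<^sup>2) = 1" "quad_form n a w = \<mu>"
    "\<And>v. (\<Sum>i<n. v i) = 0 \<Longrightarrow> quad_form n a v \<le> \<mu> * (\<Sum>i<n. (v i)\<^sup>2)"
proof -
  define K where "K = {v :: nat \<Rightarrow> real. \<forall>i. v i \<in> (if i < n then {-1..1} else {0})}
    \<inter> ({v. (\<Sum>i<n. (v i)\<^sup>2) = 1} \<inter> {v. (\<Sum>i<n. v i) = 0})"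
  have cont: "continuous_on S (\<lambda>v. v i)" for S :: "(nat \<Rightarrow> real) set" and i
    by (rule continuous_on_subset[OF continuous_on_product_coordinates]) simp
  have "compact K"
    unfolding K_def
    by (intro compact_Int_closed compact_cube_functions closed_Int closed_Collect_eq
        continuous_intros cont)
  moreover have "K \<noteq> {}"
  proof -
    obtain p where p: "n = Suc (Suc p)"
      using assms by (metis One_nat_def Suc_1 Suc_le_D Suc_le_mono)
    \<comment> \<open>The vector (1, -1, 0, ...) scaled to norm one is centred; this is where two
      coordinates are needed.\<close>
    define v :: "nat \<Rightarrow> real" where
      "v i = (if i = 0 then 1 / sqrt 2 else if i = 1 then - 1 / sqrt 2 else 0)" for i
    have s: "(\<Sum>i<p. v (Suc (Suc i))) = 0" "(\<Sum>i<p. (v (Suc (Suc i)))\<^sup>2) = 0"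
      by (simp_all add: v_def)
    have "1 / sqrt 2 \<le> 1" by simp
    have "(\<Sum>i<n. v i) = 0" "(\<Sum>i<n. (v i)\<^sup>2) = 1"
      unfolding p sum.lessThan_Suc_shift using s by (auto simp: v_def power_divide)
    moreover have "v i \<in> (if i < n then {-1..1} else {0})" for i
      using p \<open>1 / sqrt 2 \<le> 1\<close> by (auto simp: v_def intro: order_trans[of _ 0])
    ultimately have "v \<in> K" by (auto simp: K_def)
    then show ?thesis by blast
  qed
  moreover have "continuous_on K (quad_form n a)"
    unfolding quad_form_def by (intro continuous_intros cont)
  ultimately obtain w where w: "w \<in> K" "\<And>v. v \<in> K \<Longrightarrow> quad_form n a v \<le> quad_form n a w"
    using continuous_attains_sup[of K "quad_form n a"] by blast
  show thesis
  proof (rule that[of w "quad_form n a w"])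
    fix v :: "nat \<Rightarrow> real"
    assume v0: "(\<Sum>i<n. v i) = 0"
    define s where "s = (\<Sum>i<n. (v i)\<^sup>2)"
    show "quad_form n a v \<le> quad_form n a w * (\<Sum>i<n. (v i)\<^sup>2)"
    proof (cases "s = 0")
      case True
      then have "\<And>i. i < n \<Longrightarrow> v i = 0" unfolding s_def by (simp add: sum_nonneg_eq_0_iff)
      then have "quad_form n a v = 0" by (simp add: quad_form_def)
      with True show ?thesis by (simp add: s_def)
    next
      case False
      then have s: "s > 0" unfolding s_def by (metis less_eq_real_def sum_nonneg zero_le_power2)
      define u where "u i = (if i < n then inverse (sqrt s) * v i else 0)" for i
      have sq: "(\<Sum>i<n. (u i)\<^sup>2) = 1"
      proof -
        have "(\<Sum>i<n. (u i)\<^sup>2) = (\<Sum>i<n. inverse s * (v i)\<^sup>2)"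
          using s by (intro sum.cong refl) (simp add: u_def power_mult_distrib power_inverse)
        also have "\<dots> = 1" using s by (simp add: sum_distrib_left[symmetric] s_def[symmetric])
        finally show ?thesis .
      qed
      have "(\<Sum>i<n. u i) = 0"
        using v0 by (simp add: u_def sum_distrib_left[symmetric])
      moreover have "u i \<in> {-1..1}" if "i < n" for i
      proof -
        have "(u i)\<^sup>2 \<le> 1" unfolding sq[symmetric]
          using that by (intro member_le_sum) auto
        then have "\<bar>u i\<bar> \<le> 1" by (simp add: abs_square_le_1)
        then show ?thesis by auto
      qed
      ultimately have "u \<in> K" using sq by (auto simp: K_def u_def)
      then have "quad_form n a u \<le> quad_form n a w" by (rule w(2))
      moreover have "quad_form n a u = (inverse (sqrt s))\<^sup>2 * quad_form n a v"
        unfolding quad_form_scale[symmetric] by (simp add: quad_form_def u_def)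
      ultimately have "inverse s * quad_form n a v \<le> quad_form n a w"
        using s by (simp add: power_inverse)
      then show ?thesis using s by (simp add: s_def[symmetric] field_simps)
    qed
  qed (use w in \<open>auto simp: K_def\<close>)
qed

text \<open>The residual \<open>h\<close> of the eigenvalue equation is itself centred, because
  symmetry turns zero row sums into zero column sums. It is therefore an admissible direction of
  variation at the maximiser, and the first-order condition along it forces \<open>h\<close> to
  vanish.\<close>

lemma max_rayleigh_centred_eigenvector:
  assumes "n \<ge> 2"
    and sym: "\<And>i j. i < n \<Longrightarrow> j < n \<Longrightarrow> a i j = a j i"
    and row: "\<And>i. i < n \<Longrightarrow> (\<Sum>j<n. a i j) = 0"
  obtains \<mu> w where "(\<Sum>i<n. w i) = 0" "(\<Sum>i<n. (w i)\<^sup>2) = 1"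
    "\<And>i. i < n \<Longrightarrow> (\<Sum>j<n. a i j * w j) = \<mu> * w i"
    "\<And>v. (\<Sum>i<n. v i) = 0 \<Longrightarrow> quad_form n a v \<le> \<mu> * (\<Sum>i<n. (v i)\<^sup>2)"
proof -
  obtain \<mu> w where w: "(\<Sum>i<n. w i) = 0" "(\<Sum>i<n. (w i)\<^sup>2) = 1" "quad_form n a w = \<mu>"
    and max: "\<And>v. (\<Sum>i<n. v i) = 0 \<Longrightarrow> quad_form n a v \<le> \<mu> * (\<Sum>i<n. (v i)\<^sup>2)"
    using exists_max_rayleigh_centred[OF assms(1)] by metis
  define h where "h i = (\<Sum>j<n. a i j * w j) - \<mu> * w i" for i
  have "(\<Sum>i<n. \<Sum>j<n. a i j * w j) = (\<Sum>j<n. w j * (\<Sum>i<n. a j i))"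
    unfolding sum_distrib_left
    by (subst sum.swap) (intro sum.cong refl, simp add: sym mult_ac)
  also have "\<dots> = 0" by (simp add: row)
  finally have h0: "(\<Sum>i<n. h i) = 0"
    by (simp add: h_def sum_subtractf sum_distrib_left[symmetric] w)
  \<comment> \<open>The constant terms cancel because \<open>quad_form n a w = \<mu>\<close>, and
    the linear coefficient is the squared norm of \<open>h\<close>.\<close>
  have "2 * t * (\<Sum>i<n. (h i)\<^sup>2) + t\<^sup>2 * (quad_form n a h - \<mu> * (\<Sum>i<n. (h i)\<^sup>2)) \<le> 0" for t
  proof -
    have "quad_form n a (\<lambda>i. w i + t * h i) \<le> \<mu> * (\<Sum>i<n. (w i + t * h i)\<^sup>2)"
      by (rule max) (simp add: sum.distrib sum_distrib_left[symmetric] w h0)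
    moreover have "(\<Sum>i<n. (w i + t * h i)\<^sup>2)
        = 1 + 2 * t * (\<Sum>i<n. h i * w i) + t\<^sup>2 * (\<Sum>i<n. (h i)\<^sup>2)"
      by (simp add: power2_sum sum.distrib sum_distrib_left w power_mult_distrib mult_ac)
    moreover have "(\<Sum>i<n. h i * (\<Sum>j<n. a i j * w j))
        = (\<Sum>i<n. (h i)\<^sup>2) + \<mu> * (\<Sum>i<n. h i * w i)"
      unfolding sum_distrib_left[of \<mu>] sum.distrib[symmetric]
      by (intro sum.cong refl) (simp add: h_def power2_eq_square algebra_simps)
    ultimately show ?thesis
      by (simp add: quad_form_add_scaled[OF sym] w(3) algebra_simps)
  qed
  then have "(\<Sum>i<n. (h i)\<^sup>2) = 0" by (rule linear_coeff_zero)
  then have "\<And>i. i < n \<Longrightarrow> h i = 0" by (simp add: sum_nonneg_eq_0_iff)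
  then show thesis
    using that[of w \<mu>] w max by (simp add: h_def)
qed

section \<open>The second eigenvalue\<close>

text \<open>
  The all-ones vector spans the kernel direction that is split off by the basis
  $1, e_1, \dots, e_p$; the remaining block acts on the quotient. This is how the multiplicity of
  the eigenvalue 0 is tracked without diagonalising \<open>A\<close>.
\<close>

lemma char_poly_zero_row_sums:
  fixes A :: "real mat"
  assumes A: "A \<in> carrier_mat (Suc p) (Suc p)"
    and row: "\<And>i. i < Suc p \<Longrightarrow> (\<Sum>j<Suc p. A $$ (i, j)) = 0"
  shows "char_poly A
    = [:0, 1:] * char_poly (mat p p (\<lambda>(i, j). A $$ (Suc i, Suc j) - A $$ (0, Suc j)))"
proof -
  let ?n = "Suc p"
  define A3 where "A3 = mat p p (\<lambda>(i, j). A $$ (Suc i, Suc j) - A $$ (0, Suc j))"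
  define A2 where "A2 = mat 1 p (\<lambda>(i, j). A $$ (0, Suc j))"
  \<comment> \<open>\<open>B\<close> is the matrix of \<open>A\<close> in the basis formed by the
    columns of \<open>W\<close>, whose inverse is \<open>V\<close>. Its first column is zero since
    \<open>A\<close> kills the all-ones vector, and \<open>A3\<close> is the action on the
    quotient.\<close>
  define B where "B = four_block_mat (0\<^sub>m 1 1) A2 (0\<^sub>m p 1) A3"
  define W :: "real mat" where
    "W = mat ?n ?n (\<lambda>(i, j). if j = 0 \<or> i = j then 1 else 0)"
  define V :: "real mat" where
    "V = mat ?n ?n (\<lambda>(i, j). if i = j then 1 else if j = 0 then - 1 else 0)"
  have B: "B \<in> carrier_mat ?n ?n"
    unfolding B_def by (rule carrier_matI) (auto simp: A2_def A3_def)
  have W: "W \<in> carrier_mat ?n ?n" and V: "V \<in> carrier_mat ?n ?n"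
    by (auto simp: W_def V_def)
  have shift: "(\<Sum>k = 0..<?n. g k) = g 0 + (\<Sum>k<p. g (Suc k))" for g :: "nat \<Rightarrow> real"
    using sum.lessThan_Suc_shift[of g p] by (simp add: atLeast0LessThan)
  have WV: "W * V = 1\<^sub>m ?n"
  proof (rule eq_matI)
    fix i j assume "i < dim_row (1\<^sub>m ?n :: real mat)" "j < dim_col (1\<^sub>m ?n :: real mat)"
    then have ij: "i < ?n" "j < ?n" by auto
    then have "(W * V) $$ (i, j) = (\<Sum>k = 0..<?n. W $$ (i, k) * V $$ (k, j))"
      using W V by (simp add: scalar_prod_def)
    also have "\<dots> = V $$ (0, j) + (\<Sum>k<p. if Suc k = i then V $$ (i, j) else 0)"
      unfolding shift using ij by (intro arg_cong2[of _ _ _ _ "(+)"] sum.cong) (auto simp: W_def)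
    also have "\<dots> = (if i = 0 then V $$ (0, j) else V $$ (0, j) + V $$ (i, j))"
      using ij by (cases i) auto
    also have "\<dots> = 1\<^sub>m ?n $$ (i, j)"
      using ij by (auto simp: V_def)
    finally show "(W * V) $$ (i, j) = 1\<^sub>m ?n $$ (i, j)" .
  qed (use W V in auto)
  have VW: "V * W = 1\<^sub>m ?n"
    using mat_mult_left_right_inverse[OF W V WV] .
  have AW: "A * W = W * B"
  proof (rule eq_matI)
    fix i j assume "i < dim_row (W * B)" "j < dim_col (W * B)"
    then have ij: "i < ?n" "j < ?n" using W B by auto
    have "(A * W) $$ (i, j) = (\<Sum>k = 0..<?n. A $$ (i, k) * W $$ (k, j))"
      using A W ij by (simp add: scalar_prod_def)
    also have "\<dots> = (if j = 0 then 0 else A $$ (i, j))"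
    proof (cases "j = 0")
      case True
      then have "(\<Sum>k = 0..<?n. A $$ (i, k) * W $$ (k, j)) = (\<Sum>k<?n. A $$ (i, k))"
        unfolding atLeast0LessThan using ij by (intro sum.cong) (auto simp: W_def)
      then show ?thesis using True row[OF ij(1)] by simp
    next
      case False
      then have "(\<Sum>k = 0..<?n. A $$ (i, k) * W $$ (k, j))
          = (\<Sum>k = 0..<?n. if k = j then A $$ (i, k) else 0)"
        using ij by (intro sum.cong) (auto simp: W_def)
      then show ?thesis using False ij by simp
    qed
    finally have 1: "(A * W) $$ (i, j) = (if j = 0 then 0 else A $$ (i, j))" .
    have "(W * B) $$ (i, j) = (\<Sum>k = 0..<?n. W $$ (i, k) * B $$ (k, j))"
      using W B ij by (simp add: scalar_prod_def)
    also have "\<dots> = B $$ (0, j) + (\<Sum>k<p. if Suc k = i then B $$ (i, j) else 0)"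
      unfolding shift using ij by (intro arg_cong2[of _ _ _ _ "(+)"] sum.cong) (auto simp: W_def)
    also have "\<dots> = (if i = 0 then B $$ (0, j) else B $$ (0, j) + B $$ (i, j))"
      using ij by (cases i) auto
    also have "\<dots> = (if j = 0 then 0 else A $$ (i, j))"
      using ij by (cases i; cases j) (auto simp: B_def A2_def A3_def)
    finally show "(A * W) $$ (i, j) = (W * B) $$ (i, j)" using 1 by simp
  qed (use A W B in auto)
  have "A = A * (W * V)" using A WV by simp
  also have "\<dots> = W * B * V" using A W V AW by (metis assoc_mult_mat)
  finally have "similar_mat A B"
    using A B W V WV VW by (intro similar_matI[of A B W V ?n]) auto
  then have "char_poly A = char_poly B" by (rule char_poly_similar)
  also have "\<dots> = char_poly (0\<^sub>m 1 1 :: real mat) * char_poly A3"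
    unfolding B_def by (rule char_poly_four_block_zeros_col) (auto simp: A2_def A3_def)
  also have "char_poly (0\<^sub>m 1 1 :: real mat) = [:0, 1:]"
    by (simp add: char_poly_defs det_def sign_def)
  finally show ?thesis unfolding A3_def .
qed

text \<open>A centred nonzero \<open>w\<close> is not a multiple of the all-ones vector, so its
  class in the quotient is still an eigenvector there. Hence \<mu> is a root of the characteristic
  polynomial after one factor for the eigenvalue 0 is removed, that is, an entry of the list after
  its head; all of these are at most \<open>es ! 1\<close>.\<close>

lemma second_eigenvalue_bounds:
  assumes A: "A \<in> carrier_mat n n" and n: "n \<ge> 2"
    and row: "\<And>i. i < n \<Longrightarrow> (\<Sum>j<n. A $$ (i, j)) = 0"
    and eig: "eigenvalues_decreasing A es" "es ! 0 = 0"
    and w: "(\<Sum>i<n. w i) = 0" "(\<Sum>i<n. (w i)\<^sup>2) = 1"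
    and Aw: "\<And>i. i < n \<Longrightarrow> (\<Sum>j<n. A $$ (i, j) * w j) = \<mu> * w i"
  shows "\<mu> \<le> es ! 1" "es ! 1 \<le> 0"
proof -
  obtain p where p: "n = Suc p" using n by (cases n) auto
  have cp: "char_poly A = (\<Prod>a\<leftarrow>es. [:- a, 1:])" and sorted: "sorted_wrt (\<ge>) es"
    using eig by (auto simp: eigenvalues_decreasing_def)
  \<comment> \<open>Comparing degrees gives the length \<open>n\<close>, so \<open>n \<ge> 2\<close>
    makes \<open>es ! 1\<close> a genuine entry.\<close>
  have len: "length es = n"
    using degree_monic_char_poly[OF A] degree_linear_factors[of uminus es] cp by simp
  obtain e1 rest where es: "es = 0 # e1 # rest"
    using len n eig(2) by (cases es; cases "tl es") auto
  show "es ! 1 \<le> 0" using sorted by (simp add: es)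
  define A3 where "A3 = mat p p (\<lambda>(i, j). A $$ (Suc i, Suc j) - A $$ (0, Suc j))"
  have A3: "A3 \<in> carrier_mat p p" by (simp add: A3_def)
  have "[:0, 1:] * char_poly A3 = [:0, 1:] * (\<Prod>a\<leftarrow>e1 # rest. [:- a, 1:])"
    using char_poly_zero_row_sums[of A p] A row cp by (simp add: p A3_def es)
  then have cp3: "char_poly A3 = (\<Prod>a\<leftarrow>e1 # rest. [:- a, 1:])"
    by (metis mult_cancel_left pCons_eq_0_iff zero_neq_one)
  \<comment> \<open>\<open>u\<close> is the image of \<open>w\<close> in the quotient by the all-ones vector.\<close>
  define u where "u = vec p (\<lambda>i. w (Suc i) - w 0)"
  have "u \<noteq> 0\<^sub>v p"
  proof
    assume "u = 0\<^sub>v p"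
    then have "w (Suc i) = w 0" if "i < p" for i
      using that by (auto simp: u_def dest!: arg_cong[where f = "\<lambda>v. vec_index v i"])
    then have const: "w i = w 0" if "i < n" for i
      using that p by (cases i) auto
    have "(\<Sum>i<n. w i) = (\<Sum>i<n. w 0)"
      by (intro sum.cong refl const) simp
    with w(1) n have "w 0 = 0" by simp
    with const have "(\<Sum>i<n. (w i)\<^sup>2) = 0" by (intro sum.neutral) auto
    with w(2) show False by simp
  qed
  moreover have "A3 *\<^sub>v u = \<mu> \<cdot>\<^sub>v u"
  proof (rule eq_vecI)
    fix i assume "i < dim_vec (\<mu> \<cdot>\<^sub>v u)"
    then have i: "i < p" by (simp add: u_def)
    \<comment> \<open>Subtracting the constant \<open>w 0\<close> kills the term with index 0 and
      leaves the product with \<open>w\<close> unchanged, as the row sums vanish.\<close>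
    have expand: "(\<Sum>j<p. A $$ (k, Suc j) * (w (Suc j) - w 0)) = \<mu> * w k" if "k < n" for k
    proof -
      have "(\<Sum>j<p. A $$ (k, Suc j) * (w (Suc j) - w 0)) = (\<Sum>j<n. A $$ (k, j) * (w j - w 0))"
        unfolding p sum.lessThan_Suc_shift by simp
      also have "\<dots> = (\<Sum>j<n. A $$ (k, j) * w j) - (\<Sum>j<n. A $$ (k, j)) * w 0"
        by (simp add: algebra_simps sum_subtractf sum_distrib_left)
      finally show ?thesis using that by (simp add: Aw row)
    qed
    have "(A3 *\<^sub>v u) $ i
        = (\<Sum>j<p. (A $$ (Suc i, Suc j) - A $$ (0, Suc j)) * (w (Suc j) - w 0))"
      using i A3 by (simp add: scalar_prod_def u_def A3_def atLeast0LessThan)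
    also have "\<dots> = \<mu> * w (Suc i) - \<mu> * w 0"
      using i expand[of "Suc i"] expand[of 0] p
      by (simp add: left_diff_distrib sum_subtractf)
    finally show "(A3 *\<^sub>v u) $ i = (\<mu> \<cdot>\<^sub>v u) $ i"
      using i by (simp add: u_def right_diff_distrib)
  qed (use A3 in \<open>auto simp: u_def\<close>)
  ultimately have "eigenvalue A3 \<mu>"
    using A3 unfolding eigenvalue_def eigenvector_def by (intro exI[of _ u]) (auto simp: u_def)
  then have "poly (\<Prod>a\<leftarrow>e1 # rest. [:- a, 1:]) \<mu> = 0"
    using eigenvalue_root_char_poly[OF A3] cp3 by simp
  then have "\<mu> \<in> set (e1 # rest)"
    by (auto simp: poly_prod_list prod_list_zero_iff)
  then show "\<mu> \<le> es ! 1" using sorted by (auto simp: es)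
qed

section \<open>Bounding the quadratic form by the second eigenvalue\<close>

lemma symmetric_mat_index:
  assumes "A \<in> carrier_mat n n" "transpose_mat A = A" "i < n" "j < n"
  shows "A $$ (i, j) = A $$ (j, i)"
proof -
  have "A $$ (i, j) = transpose_mat A $$ (i, j)" by (simp only: assms(2))
  also have "\<dots> = A $$ (j, i)" using assms(1,3,4) by simp
  finally show ?thesis .
qed

text \<open>Variational principle: the maximal Rayleigh quotient on centred vectors is attained at
  an eigenvector, so it cannot exceed the second entry of the eigenvalue list.\<close>

lemma quad_form_le_second_eigenvalue:
  assumes A: "A \<in> carrier_mat n n" and n: "n \<ge> 2" and sym: "transpose_mat A = A"
    and row: "\<And>i. i < n \<Longrightarrow> (\<Sum>j<n. A $$ (i, j)) = 0"
    and eig: "eigenvalues_decreasing A es" "es ! 0 = 0"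
  shows "es ! 1 \<le> 0 \<and> (\<forall>v. (\<Sum>i<n. v i) = 0 \<longrightarrow>
    quad_form n (\<lambda>i j. A $$ (i, j)) v \<le> es ! 1 * (\<Sum>i<n. (v i)\<^sup>2))"
proof (rule max_rayleigh_centred_eigenvector[where a = "\<lambda>i j. A $$ (i, j)", OF n _ row])
  show "A $$ (i, j) = A $$ (j, i)" if "i < n" "j < n" for i j
    by (rule symmetric_mat_index[OF A sym that])
next
  fix \<mu> w
  assume w: "(\<Sum>i<n. w i) = 0" "(\<Sum>i<n. (w i)\<^sup>2) = 1"
    "\<And>i. i < n \<Longrightarrow> (\<Sum>j<n. A $$ (i, j) * w j) = \<mu> * w i"
    and max: "\<And>v. (\<Sum>i<n. v i) = 0 \<Longrightarrow>
      quad_form n (\<lambda>i j. A $$ (i, j)) v \<le> \<mu> * (\<Sum>i<n. (v i)\<^sup>2)"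
  note bounds = second_eigenvalue_bounds[OF A n row eig w]
  have "quad_form n (\<lambda>i j. A $$ (i, j)) v \<le> es ! 1 * (\<Sum>i<n. (v i)\<^sup>2)"
    if "(\<Sum>i<n. v i) = 0" for v
  proof -
    have "quad_form n (\<lambda>i j. A $$ (i, j)) v \<le> \<mu> * (\<Sum>i<n. (v i)\<^sup>2)" by (rule max[OF that])
    also have "\<dots> \<le> es ! 1 * (\<Sum>i<n. (v i)\<^sup>2)"
      using bounds(1) by (intro mult_right_mono sum_nonneg) auto
    finally show ?thesis .
  qed
  with bounds(2) show "es ! 1 \<le> 0 \<and> (\<forall>v. (\<Sum>i<n. v i) = 0 \<longrightarrow>
    quad_form n (\<lambda>i j. A $$ (i, j)) v \<le> es ! 1 * (\<Sum>i<n. (v i)\<^sup>2))" by blast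
qed

text \<open>The scalar bound is applied to each coordinate of the deviations from the mean. Passing
  to deviations is free: the mean drops out of the right factor by the zero row sums and out of the
  left one by the zero column sums.\<close>

lemma quad_form_vector_le:
  fixes y :: "nat \<Rightarrow> 'a::euclidean_space"
  assumes n: "n \<ge> 1"
    and sym: "\<And>i j. i < n \<Longrightarrow> j < n \<Longrightarrow> a i j = a j i"
    and row: "\<And>i. i < n \<Longrightarrow> (\<Sum>j<n. a i j) = 0"
    and bound: "\<And>v. (\<Sum>i<n. v i) = 0 \<Longrightarrow> quad_form n a v \<le> \<mu> * (\<Sum>i<n. (v i)\<^sup>2)"
    and avg: "avg = (1 / real n) *\<^sub>R (\<Sum>l<n. y l)"
  shows "(\<Sum>l<n. inner (y l) (\<Sum>j<n. a l j *\<^sub>R y j)) \<le> \<mu> * (\<Sum>l<n. (norm (y l - avg))\<^sup>2)"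
proof -
  define z where "z l = y l - avg" for l
  define G where "G l = (\<Sum>j<n. a l j *\<^sub>R z j)" for l
  have norm_sq: "(norm u)\<^sup>2 = (\<Sum>b\<in>Basis. (inner u b)\<^sup>2)" for u :: 'a
    unfolding power2_norm_eq_inner by (subst euclidean_inner) (simp add: power2_eq_square)
  have z0: "(\<Sum>l<n. z l) = 0"
    using n by (simp add: z_def sum_subtractf sum_constant_scaleR avg)
  have Gy: "(\<Sum>j<n. a l j *\<^sub>R y j) = G l" if "l < n" for l
    using row[OF that]
    by (simp add: G_def z_def scaleR_diff_right sum_subtractf scaleR_left.sum[symmetric])
  have "(\<Sum>l<n. G l) = (\<Sum>j<n. (\<Sum>l<n. a j l) *\<^sub>R z j)"
    unfolding G_def scaleR_left.sum
    by (subst sum.swap) (intro sum.cong refl, simp add: sym)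
  then have G0: "(\<Sum>l<n. G l) = 0" by (simp add: row)
  have "(\<Sum>l<n. inner (y l) (\<Sum>j<n. a l j *\<^sub>R y j)) = (\<Sum>l<n. inner (z l) (G l) + inner avg (G l))"
    by (intro sum.cong refl) (simp add: Gy z_def inner_diff_left)
  also have "\<dots> = (\<Sum>l<n. inner (z l) (G l))"
    by (simp add: sum.distrib inner_sum_right[symmetric] G0)
  also have "\<dots> = (\<Sum>l<n. \<Sum>b\<in>Basis. inner (z l) b * (\<Sum>j<n. a l j * inner (z j) b))"
    by (intro sum.cong refl, subst euclidean_inner) (simp add: G_def inner_sum_left)
  also have "\<dots> = (\<Sum>b\<in>Basis. quad_form n a (\<lambda>l. inner (z l) b))"
    unfolding quad_form_def by (rule sum.swap)
  also have "\<dots> \<le> (\<Sum>b\<in>Basis. \<mu> * (\<Sum>l<n. (inner (z l) b)\<^sup>2))"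
    by (intro sum_mono bound) (simp add: inner_sum_left[symmetric] z0)
  also have "\<dots> = \<mu> * (\<Sum>l<n. \<Sum>b\<in>Basis. (inner (z l) b)\<^sup>2)"
    unfolding sum_distrib_left[symmetric] by (subst sum.swap) simp
  also have "\<dots> = \<mu> * (\<Sum>l<n. (norm (y l - avg))\<^sup>2)"
    by (simp add: norm_sq z_def)
  finally show ?thesis .
qed

section \<open>Averaging over one layer\<close>

lemma finite_nodes: "finite (nodes m I)"
  by (auto simp: nodes_def intro: finite_PiE)

lemma fun_upd_in_nodes: "i \<in> nodes m I \<Longrightarrow> k < m \<Longrightarrow> j < I k \<Longrightarrow> i(k := j) \<in> nodes m I"
  by (auto simp: nodes_def PiE_iff extensional_def)

lemma nodes_less: "i \<in> nodes m I \<Longrightarrow> k < m \<Longrightarrow> i k < I k"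
  by (auto simp: nodes_def)

text \<open>Double counting: a node is reached from each of the \<open>I k\<close> nodes on its
  fibre in direction \<open>k\<close>. Fibres can thus be summed over without choosing
  representatives.\<close>

lemma sum_nodes_fibres:
  fixes h :: "(nat \<Rightarrow> nat) \<Rightarrow> 'a::real_vector"
  assumes "k < m"
  shows "(\<Sum>i\<in>nodes m I. \<Sum>j<I k. h (i(k := j))) = real (I k) *\<^sub>R (\<Sum>i\<in>nodes m I. h i)"
proof -
  have "(\<Sum>i\<in>nodes m I. \<Sum>j<I k. h (i(k := j)))
      = (\<Sum>(i, j)\<in>nodes m I \<times> {..<I k}. h (i(k := j)))"
    by (simp add: sum.cartesian_product)
  \<comment> \<open>Exchanging \<open>i k\<close> with \<open>j\<close> is an involution of the
    pairs, hence its own inverse.\<close>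
  also have "\<dots> = (\<Sum>(i, j)\<in>nodes m I \<times> {..<I k}. h i)"
    using assms
    by (intro sum.reindex_bij_witness[where i = "\<lambda>(i, j). (i(k := j), i k)"
          and j = "\<lambda>(i, j). (i(k := j), i k)"])
      (auto simp: fun_upd_in_nodes nodes_less)
  also have "\<dots> = real (I k) *\<^sub>R (\<Sum>i\<in>nodes m I. h i)"
    by (simp add: sum.cartesian_product[symmetric] scaleR_right.sum sum_constant_scaleR)
  finally show ?thesis .
qed

text \<open>Passes from single fibres to all nodes. If \<open>I k = 0\<close> the double count gives
  nothing, but then there are no nodes.\<close>

lemma sum_nodes_eq_0:
  fixes h :: "(nat \<Rightarrow> nat) \<Rightarrow> 'a::real_vector"
  assumes "k < m" "\<And>i. i \<in> nodes m I \<Longrightarrow> (\<Sum>j<I k. h (i(k := j))) = 0"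
  shows "(\<Sum>i\<in>nodes m I. h i) = 0"
proof (cases "I k = 0")
  case True
  then have "nodes m I = {}" using nodes_less[of _ m I k] assms(1) by fastforce
  then show ?thesis by simp
next
  case False
  then show ?thesis using sum_nodes_fibres[OF assms(1), where h = h and I = I] assms(2) by simp
qed

lemma sum_nodes_mono:
  fixes g h :: "(nat \<Rightarrow> nat) \<Rightarrow> real"
  assumes "k < m"
    and "\<And>i. i \<in> nodes m I \<Longrightarrow> (\<Sum>j<I k. h (i(k := j))) \<le> (\<Sum>j<I k. g (i(k := j)))"
  shows "(\<Sum>i\<in>nodes m I. h i) \<le> (\<Sum>i\<in>nodes m I. g i)"
proof (cases "I k = 0")
  case True
  then have "nodes m I = {}" using nodes_less[of _ m I k] assms(1) by fastforce
  then show ?thesis by simp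
next
  case False
  have "real (I k) * (\<Sum>i\<in>nodes m I. h i) \<le> real (I k) * (\<Sum>i\<in>nodes m I. g i)"
    using sum_mono[where K = "nodes m I" and f = "\<lambda>i. \<Sum>j<I k. h (i(k := j))", OF assms(2)] sum_nodes_fibres[OF assms(1), where h = h and I = I]
      sum_nodes_fibres[OF assms(1), where h = g and I = I] by simp
  with False show ?thesis by simp
qed

text \<open>The projection P_k of the overview. It is defined on all index functions, so its
  invariance in direction \<open>k\<close> holds without side conditions.\<close>

definition layer_mean ::
  "(nat \<Rightarrow> nat) \<Rightarrow> nat \<Rightarrow> ((nat \<Rightarrow> nat) \<Rightarrow> 'a::real_vector) \<Rightarrow> (nat \<Rightarrow> nat) \<Rightarrow> 'a" where
  "layer_mean I k x i = (1 / real (I k)) *\<^sub>R (\<Sum>j<I k. x (i(k := j)))"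

lemma layer_mean_fun_upd [simp]: "layer_mean I k x (i(k := j)) = layer_mean I k x i"
  by (simp add: layer_mean_def)

lemma layer_mean_diff: "layer_mean I k (\<lambda>i. x i - y i) i = layer_mean I k x i - layer_mean I k y i"
  by (simp add: layer_mean_def sum_subtractf scaleR_diff_right)

lemma sum_minus_layer_mean:
  assumes "I k \<ge> 1"
  shows "(\<Sum>j<I k. x (i(k := j)) - layer_mean I k x (i(k := j))) = 0"
  using assms by (simp add: sum_subtractf sum_constant_scaleR) (simp add: layer_mean_def)

text \<open>On each fibre in direction \<open>k\<close> the mean of \<open>y\<close> is constant,
  while the deviations of \<open>x\<close> sum to zero.\<close>

lemma layer_mean_orthogonal:
  fixes x y :: "(nat \<Rightarrow> nat) \<Rightarrow> 'a::real_inner"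
  assumes "k < m" "I k \<ge> 1"
  shows "(\<Sum>i\<in>nodes m I. inner (x i - layer_mean I k x i) (layer_mean I k y i)) = 0"
proof (rule sum_nodes_eq_0[OF assms(1)])
  fix i
  have "(\<Sum>j<I k. inner (x (i(k := j)) - layer_mean I k x (i(k := j))) (layer_mean I k y (i(k := j))))
      = inner (\<Sum>j<I k. x (i(k := j)) - layer_mean I k x (i(k := j))) (layer_mean I k y i)"
    by (simp add: inner_sum_left)
  then show "(\<Sum>j<I k. inner (x (i(k := j)) - layer_mean I k x (i(k := j)))
      (layer_mean I k y (i(k := j)))) = 0"
    by (simp only: sum_minus_layer_mean[where I = I and k = k, OF assms(2)] inner_zero_left)
qed

section \<open>The Efron-Stein inequality for the layer means\<close>

lemma sum_norm_add_sq:
  fixes x y :: "'b \<Rightarrow> 'a::real_inner"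
  shows "(\<Sum>i\<in>S. (norm (x i + y i))\<^sup>2)
    = (\<Sum>i\<in>S. (norm (x i))\<^sup>2) + 2 * (\<Sum>i\<in>S. inner (x i) (y i)) + (\<Sum>i\<in>S. (norm (y i))\<^sup>2)"
  by (simp add: power2_norm_eq_inner inner_add_left inner_add_right inner_commute
      sum.distrib sum_distrib_left algebra_simps)

lemma layer_mean_contraction:
  fixes x :: "(nat \<Rightarrow> nat) \<Rightarrow> 'a::real_inner"
  assumes "k < m" "I k \<ge> 1"
  shows "(\<Sum>i\<in>nodes m I. (norm (layer_mean I k x i))\<^sup>2) \<le> (\<Sum>i\<in>nodes m I. (norm (x i))\<^sup>2)"
proof -
  have "(\<Sum>i\<in>nodes m I. (norm (x i))\<^sup>2)
      = (\<Sum>i\<in>nodes m I. (norm ((x i - layer_mean I k x i) + layer_mean I k x i))\<^sup>2)" by simp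
  also have "\<dots> = (\<Sum>i\<in>nodes m I. (norm (x i - layer_mean I k x i))\<^sup>2)
      + (\<Sum>i\<in>nodes m I. (norm (layer_mean I k x i))\<^sup>2)"
    by (simp only: sum_norm_add_sq layer_mean_orthogonal[where k = k and I = I, OF assms])
  finally show ?thesis by (simp add: sum_nonneg)
qed

text \<open>Induction on the number of layers averaged so far; the witness is the result of applying
  the first \<open>q\<close> layer means to \<open>x\<close> in turn.\<close>

lemma exists_invariant_approximation:
  fixes x :: "(nat \<Rightarrow> nat) \<Rightarrow> 'a::real_inner"
  assumes I: "\<And>k. k < m \<Longrightarrow> I k \<ge> 1" and "q \<le> m"
  shows "\<exists>z. (\<forall>k<q. \<forall>i j. z (i(k := j)) = z i) \<and>
    (\<Sum>i\<in>nodes m I. (norm (x i - z i))\<^sup>2)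
      \<le> (\<Sum>k<q. \<Sum>i\<in>nodes m I. (norm (x i - layer_mean I k x i))\<^sup>2)"
  using \<open>q \<le> m\<close>
proof (induction q)
  case 0
  then show ?case by (intro exI[of _ x]) simp
next
  case (Suc q)
  obtain z where inv: "\<And>k i j. k < q \<Longrightarrow> z (i(k := j)) = z i"
    and z: "(\<Sum>i\<in>nodes m I. (norm (x i - z i))\<^sup>2)
      \<le> (\<Sum>k<q. \<Sum>i\<in>nodes m I. (norm (x i - layer_mean I k x i))\<^sup>2)"
    using Suc.IH[OF Suc_leD[OF Suc.prems]] by blast
  have q: "q < m" "I q \<ge> 1" using Suc.prems I by auto
  show ?case
  proof (intro exI[of _ "layer_mean I q z"] conjI allI impI)
    fix k i j assume "k < Suc q"
    then consider "k = q" | "k < q" by linarith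
    then show "layer_mean I q z (i(k := j)) = layer_mean I q z i"
    proof cases
      case 2
      \<comment> \<open>Updates at distinct positions commute, so averaging in direction
        \<open>q\<close> preserves invariance in the earlier directions.\<close>
      then have "z (i(k := j, q := l)) = z (i(q := l))" for l
        using inv[of k "i(q := l)" j] by (simp add: fun_upd_twist)
      then show ?thesis by (simp add: layer_mean_def)
    qed simp
  next
    \<comment> \<open>The split x - P_q z = (x - P_q x) + P_q (x - z) is orthogonal. The first part
      is the new summand; the second is at most x - z in norm by contraction.\<close>
    have "(\<Sum>i\<in>nodes m I. (norm (x i - layer_mean I q z i))\<^sup>2)
        = (\<Sum>i\<in>nodes m I. (norm ((x i - layer_mean I q x i)
            + layer_mean I q (\<lambda>i. x i - z i) i))\<^sup>2)"
      by (simp add: layer_mean_diff)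
    also have "\<dots> = (\<Sum>i\<in>nodes m I. (norm (x i - layer_mean I q x i))\<^sup>2)
        + (\<Sum>i\<in>nodes m I. (norm (layer_mean I q (\<lambda>i. x i - z i) i))\<^sup>2)"
      by (simp only: sum_norm_add_sq layer_mean_orthogonal[where k = q and I = I, OF q])
    also have "\<dots> \<le> (\<Sum>i\<in>nodes m I. (norm (x i - layer_mean I q x i))\<^sup>2)
        + (\<Sum>i\<in>nodes m I. (norm (x i - z i))\<^sup>2)"
      using layer_mean_contraction[where k = q and I = I, OF q, of "\<lambda>i. x i - z i"] by simp
    finally show "(\<Sum>i\<in>nodes m I. (norm (x i - layer_mean I q z i))\<^sup>2)
      \<le> (\<Sum>k<Suc q. \<Sum>i\<in>nodes m I. (norm (x i - layer_mean I k x i))\<^sup>2)"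
      using z by simp
  qed
qed

lemma invariant_constant_on_nodes:
  assumes inv: "\<And>k i j. k < m \<Longrightarrow> z (i(k := j)) = z i"
    and "i \<in> nodes m I" "i' \<in> nodes m I"
  shows "z i = z i'"
proof -
  \<comment> \<open>The coordinates of \<open>i\<close> are replaced by those of \<open>i'\<close>
    one at a time.\<close>
  have "z (\<lambda>k. if k < q then i' k else i k) = z i" if "q \<le> m" for q
    using that
  proof (induction q)
    case (Suc q)
    have "(\<lambda>k. if k < Suc q then i' k else i k) = (\<lambda>k. if k < q then i' k else i k)(q := i' q)"
      by (auto simp: less_Suc_eq)
    then show ?case using Suc inv[of q] by simp
  qed simp
  \<comment> \<open>Nodes are undefined from index \<open>m\<close> on, so replacing the first
    \<open>m\<close> coordinates already yields \<open>i'\<close>.\<close>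
  moreover have "(\<lambda>k. if k < m then i' k else i k) = i'"
    using assms(2,3) by (auto simp: nodes_def PiE_iff extensional_def)
  ultimately show ?thesis by force
qed

text \<open>Bilinear variance identity: when \<open>x\<close> or \<open>y\<close> sums to zero, the
  sum over pairs reduces to a single sum over nodes.\<close>

lemma sum_pairs_inner:
  fixes x y :: "'b \<Rightarrow> 'a::real_inner"
  shows "(\<Sum>i\<in>S. \<Sum>j\<in>S. inner (x i - x j) (y i - y j))
    = 2 * real (card S) * (\<Sum>i\<in>S. inner (x i) (y i)) - 2 * inner (\<Sum>i\<in>S. x i) (\<Sum>i\<in>S. y i)"
proof -
  have "(\<Sum>i\<in>S. \<Sum>j\<in>S. inner (x i - x j) (y i - y j))
      = (\<Sum>i\<in>S. \<Sum>j\<in>S. inner (x i) (y i)) + (\<Sum>i\<in>S. \<Sum>j\<in>S. inner (x j) (y j))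
        - (\<Sum>i\<in>S. \<Sum>j\<in>S. inner (x i) (y j)) - (\<Sum>i\<in>S. \<Sum>j\<in>S. inner (x j) (y i))"
    by (simp add: inner_diff_left inner_diff_right sum.distrib sum_subtractf)
  moreover have "(\<Sum>i\<in>S. \<Sum>j\<in>S. inner (x i) (y j)) = inner (\<Sum>i\<in>S. x i) (\<Sum>i\<in>S. y i)"
    by (subst sum.swap) (simp add: inner_sum_left inner_sum_right)
  moreover have "(\<Sum>i\<in>S. \<Sum>j\<in>S. inner (x j) (y i)) = inner (\<Sum>i\<in>S. x i) (\<Sum>i\<in>S. y i)"
    by (simp add: inner_sum_left inner_sum_right)
  ultimately show ?thesis by (simp add: sum_distrib_left mult.assoc)
qed

text \<open>Differences between nodes do not change when the invariant approximation, constant on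
  the nodes, is subtracted. The variance identity then bounds the sum over pairs by a multiple of
  the squared distance to it.\<close>

lemma sum_pairs_le_layers:
  fixes x :: "(nat \<Rightarrow> nat) \<Rightarrow> 'a::real_inner"
  assumes I: "\<And>k. k < m \<Longrightarrow> I k \<ge> 1"
  shows "(\<Sum>i\<in>nodes m I. \<Sum>j\<in>nodes m I. (norm (x i - x j))\<^sup>2)
    \<le> 2 * real (card (nodes m I))
        * (\<Sum>k<m. \<Sum>i\<in>nodes m I. (norm (x i - layer_mean I k x i))\<^sup>2)"
proof -
  obtain z where inv: "\<And>k i j. k < m \<Longrightarrow> z (i(k := j)) = z i"
    and z: "(\<Sum>i\<in>nodes m I. (norm (x i - z i))\<^sup>2)
      \<le> (\<Sum>k<m. \<Sum>i\<in>nodes m I. (norm (x i - layer_mean I k x i))\<^sup>2)"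
    using exists_invariant_approximation[of m I m x] I by blast
  have const: "z i = z j" if "i \<in> nodes m I" "j \<in> nodes m I" for i j
    using invariant_constant_on_nodes[of m z] inv that by blast
  have "(\<Sum>i\<in>nodes m I. \<Sum>j\<in>nodes m I. (norm (x i - x j))\<^sup>2)
      = (\<Sum>i\<in>nodes m I. \<Sum>j\<in>nodes m I.
          inner ((x i - z i) - (x j - z j)) ((x i - z i) - (x j - z j)))"
  proof (intro sum.cong refl)
    fix i j assume "i \<in> nodes m I" "j \<in> nodes m I"
    then have "z i = z j" by (rule const)
    then show "(norm (x i - x j))\<^sup>2 = inner ((x i - z i) - (x j - z j)) ((x i - z i) - (x j - z j))"
      by (simp add: power2_norm_eq_inner)
  qed
  also have "\<dots> \<le> 2 * real (card (nodes m I)) * (\<Sum>i\<in>nodes m I. (norm (x i - z i))\<^sup>2)"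
    unfolding sum_pairs_inner by (simp add: power2_norm_eq_inner)
  also have "\<dots> \<le> 2 * real (card (nodes m I))
      * (\<Sum>k<m. \<Sum>i\<in>nodes m I. (norm (x i - layer_mean I k x i))\<^sup>2)"
    using z by (intro mult_left_mono) auto
  finally show ?thesis .
qed

section \<open>Dissipativity and synchronization\<close>

definition layer_coupling ::
  "(nat \<Rightarrow> nat) \<Rightarrow> nat \<Rightarrow> (nat \<Rightarrow> nat \<Rightarrow> real) \<Rightarrow> ((nat \<Rightarrow> nat) \<Rightarrow> 'a::real_vector) \<Rightarrow> (nat \<Rightarrow> nat) \<Rightarrow> 'a" where
  "layer_coupling I k a x i = (\<Sum>j<I k. a (i k) j *\<^sub>R x (i(k := j)))"

text \<open>Each fibre in direction \<open>k\<close> carries the same coupling matrix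
  \<open>a\<close>, so the vector bound applies to it with the layer mean as average.\<close>

lemma layer_coupling_dissipative:
  fixes x :: "(nat \<Rightarrow> nat) \<Rightarrow> 'a::euclidean_space"
  assumes "k < m" "I k \<ge> 1"
    and sym: "\<And>i j. i < I k \<Longrightarrow> j < I k \<Longrightarrow> a i j = a j i"
    and row: "\<And>i. i < I k \<Longrightarrow> (\<Sum>j<I k. a i j) = 0"
    and bound: "\<And>v. (\<Sum>i<I k. v i) = 0 \<Longrightarrow> quad_form (I k) a v \<le> \<mu> * (\<Sum>i<I k. (v i)\<^sup>2)"
  shows "(\<Sum>i\<in>nodes m I. inner (x i) (layer_coupling I k a x i))
    \<le> \<mu> * (\<Sum>i\<in>nodes m I. (norm (x i - layer_mean I k x i))\<^sup>2)"
  unfolding sum_distrib_left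
proof (rule sum_nodes_mono[OF assms(1)])
  fix i
  show "(\<Sum>l<I k. inner (x (i(k := l))) (layer_coupling I k a x (i(k := l))))
    \<le> (\<Sum>l<I k. \<mu> * (norm (x (i(k := l)) - layer_mean I k x (i(k := l))))\<^sup>2)"
    using quad_form_vector_le[OF assms(2) sym row bound, of "layer_mean I k x i" "\<lambda>l. x (i(k := l))"]
    by (simp add: layer_coupling_def sum_distrib_left layer_mean_def)
qed

lemma sum_layer_coupling:
  assumes "k < m"
    and sym: "\<And>i j. i < I k \<Longrightarrow> j < I k \<Longrightarrow> a i j = a j i"
    and row: "\<And>i. i < I k \<Longrightarrow> (\<Sum>j<I k. a i j) = 0"
  shows "(\<Sum>i\<in>nodes m I. layer_coupling I k a x i) = 0"
proof (rule sum_nodes_eq_0[OF assms(1)])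
  fix i
  have "(\<Sum>l<I k. layer_coupling I k a x (i(k := l))) = (\<Sum>j<I k. (\<Sum>l<I k. a j l) *\<^sub>R x (i(k := j)))"
    unfolding scaleR_left.sum layer_coupling_def
    by (simp, subst sum.swap) (intro sum.cong refl, simp add: sym)
  then show "(\<Sum>l<I k. layer_coupling I k a x (i(k := l))) = 0" by (simp add: row)
qed

text \<open>The node dynamics are controlled pair by pair through \<open>f\<close>. The coupling
  \<open>G\<close> has total zero, so the variance identity reduces its sum over pairs to a sum over
  nodes, to which the layerwise bounds apply.\<close>

lemma network_dissipative:
  fixes x :: "(nat \<Rightarrow> nat) \<Rightarrow> 'a::euclidean_space"
  assumes I: "\<And>k. k < m \<Longrightarrow> I k \<ge> 1"
    and f: "\<And>x y. inner (x - y) (f x - f y) \<le> \<alpha> * inner (x - y) (x - y)"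
    and sym: "\<And>k i j. k < m \<Longrightarrow> i < I k \<Longrightarrow> j < I k \<Longrightarrow> a k i j = a k j i"
    and row: "\<And>k i. k < m \<Longrightarrow> i < I k \<Longrightarrow> (\<Sum>j<I k. a k i j) = 0"
    and bound: "\<And>k v. k < m \<Longrightarrow> (\<Sum>i<I k. v i) = 0 \<Longrightarrow>
      quad_form (I k) (a k) v \<le> \<mu> * (\<Sum>i<I k. (v i)\<^sup>2)"
    and \<mu>: "\<mu> \<le> 0"
    and F: "\<And>i. F i = f (x i) + (\<Sum>k<m. layer_coupling I k (a k) x i)"
  shows "(\<Sum>i\<in>nodes m I. \<Sum>j\<in>nodes m I. inner (x i - x j) (F i - F j))
    \<le> (\<alpha> + \<mu>) * (\<Sum>i\<in>nodes m I. \<Sum>j\<in>nodes m I. (norm (x i - x j))\<^sup>2)"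
proof -
  define G where "G i = (\<Sum>k<m. layer_coupling I k (a k) x i)" for i
  let ?N = "nodes m I"
  let ?W = "\<Sum>i\<in>?N. \<Sum>j\<in>?N. (norm (x i - x j))\<^sup>2"
  let ?D = "\<Sum>k<m. \<Sum>i\<in>?N. (norm (x i - layer_mean I k x i))\<^sup>2"
  have "(\<Sum>i\<in>?N. \<Sum>j\<in>?N. inner (x i - x j) (f (x i) - f (x j))) \<le> \<alpha> * ?W"
    unfolding sum_distrib_left power2_norm_eq_inner by (intro sum_mono f)
  moreover have "(\<Sum>i\<in>?N. \<Sum>j\<in>?N. inner (x i - x j) (G i - G j)) \<le> \<mu> * ?W"
  proof -
    have G0: "(\<Sum>i\<in>?N. G i) = 0"
      unfolding G_def by (subst sum.swap) (simp add: sum_layer_coupling sym row)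
    have "(\<Sum>i\<in>?N. inner (x i) (G i))
        = (\<Sum>k<m. \<Sum>i\<in>?N. inner (x i) (layer_coupling I k (a k) x i))"
      unfolding G_def inner_sum_right by (rule sum.swap)
    also have "\<dots> \<le> (\<Sum>k<m. \<mu> * (\<Sum>i\<in>?N. (norm (x i - layer_mean I k x i))\<^sup>2))"
      by (intro sum_mono layer_coupling_dissipative I sym row bound) auto
    finally have "(\<Sum>i\<in>?N. inner (x i) (G i)) \<le> \<mu> * ?D"
      by (simp add: sum_distrib_left)
    then have "2 * real (card ?N) * (\<Sum>i\<in>?N. inner (x i) (G i)) \<le> 2 * real (card ?N) * (\<mu> * ?D)"
      by (intro mult_left_mono) auto
    also have "\<dots> = \<mu> * (2 * real (card ?N) * ?D)" by simp
    \<comment> \<open>Since \<mu> is nonpositive, multiplying by it reverses the Efron-Stein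
      inequality, giving the direction required here.\<close>
    also have "\<dots> \<le> \<mu> * ?W"
      using \<mu> sum_pairs_le_layers[of m I x] I by (intro mult_left_mono_neg) auto
    finally show ?thesis by (simp add: sum_pairs_inner G0)
  qed
  moreover have "(\<Sum>i\<in>?N. \<Sum>j\<in>?N. inner (x i - x j) (F i - F j))
      = (\<Sum>i\<in>?N. \<Sum>j\<in>?N. inner (x i - x j) (f (x i) - f (x j)))
        + (\<Sum>i\<in>?N. \<Sum>j\<in>?N. inner (x i - x j) (G i - G j))"
    by (simp add: F G_def sum.distrib[symmetric] inner_add_right[symmetric] add_diff_add)
  ultimately show ?thesis by (simp add: distrib_right)
qed

section \<open>From the differential inequality to synchronization\<close>

lemma exponential_decay:
  fixes W D :: "real \<Rightarrow> real"
  assumes W: "\<And>t. t \<ge> 0 \<Longrightarrow> (W has_real_derivative D t) (at t within {0..})"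
    and D: "\<And>t. t \<ge> 0 \<Longrightarrow> D t \<le> - r * W t"
    and r: "r > 0" and nonneg: "\<And>t. W t \<ge> 0"
  shows "(W \<longlongrightarrow> 0) at_top"
proof -
  \<comment> \<open>With the integrating factor, the derivative of \<open>E\<close> is nonpositive
    wherever \<open>D t \<le> - r * W t\<close>.\<close>
  define E where "E t = exp (r * t) * W t" for t
  have E': "(E has_real_derivative exp (r * t) * (r * W t + D t)) (at t within {0..})"
    if "t \<ge> 0" for t
  proof -
    have "((\<lambda>t. exp (r * t)) has_real_derivative exp (r * t) * r) (at t within {0..})"
      by (auto intro!: derivative_eq_intros)
    from DERIV_mult[OF this W[OF that]] show ?thesis
      unfolding E_def by (rule DERIV_cong) (simp add: algebra_simps)
  qed
  have bound: "W t \<le> exp (- r * t) * W 0" if t: "t \<ge> 0" for t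
  proof -
    have "E t \<le> E 0"
    proof (rule DERIV_nonpos_imp_decreasing_open[OF t])
      fix s assume s: "0 < s" "s < t"
      \<comment> \<open>At positive times the derivative is two-sided; the endpoint 0 enters only
        through continuity.\<close>
      have "at s within {0..} = at s"
        by (rule at_within_interior) (use s in simp)
      then have "DERIV E s :> exp (r * s) * (r * W s + D s)"
        using E'[of s] s by simp
      moreover have "exp (r * s) * (r * W s + D s) \<le> 0"
        using D[of s] s by (intro mult_nonneg_nonpos) auto
      ultimately show "\<exists>y. DERIV E s :> y \<and> y \<le> 0" by blast
    next
      have "continuous_on {0..} E"
        by (rule DERIV_continuous_on[OF E']) auto
      then show "continuous_on {0..t} E" by (rule continuous_on_subset) auto
    qed
    then show ?thesis
      by (simp add: E_def exp_minus field_simps)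
  qed
  have lim: "((\<lambda>t. exp (- r * t) * W 0) \<longlongrightarrow> 0) at_top"
  proof -
    have "filterlim (\<lambda>t. - r * t) at_bot at_top"
      using r by (intro filterlim_tendsto_neg_mult_at_bot[OF tendsto_const] filterlim_ident) auto
    then have "((\<lambda>t. exp (- r * t)) \<longlongrightarrow> 0) at_top"
      by (rule filterlim_compose[OF exp_at_bot])
    then show ?thesis by (rule tendsto_mult_left_zero)
  qed
  have "\<forall>\<^sub>F t in at_top. W t \<le> exp (- r * t) * W 0"
    using eventually_ge_at_top[of "0::real"] by eventually_elim (rule bound)
  then show ?thesis
    by (rule tendsto_sandwich[OF _ _ tendsto_const lim, rotated]) (simp add: nonneg)
qed

lemma has_real_derivative_norm_sq:
  fixes u :: "real \<Rightarrow> 'a::real_inner"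
  assumes "(u has_vector_derivative u') (at t within S)"
  shows "((\<lambda>t. (norm (u t))\<^sup>2) has_real_derivative 2 * inner (u t) u') (at t within S)"
proof -
  have u: "(u has_derivative (\<lambda>h. h *\<^sub>R u')) (at t within S)"
    using assms by (simp add: has_vector_derivative_def)
  show ?thesis
    unfolding power2_norm_eq_inner has_field_derivative_def
    by (rule has_derivative_eq_rhs[OF has_derivative_inner[OF u u]])
      (simp add: fun_eq_iff inner_commute)
qed

theorem corollary1:
  fixes m :: nat
    and I :: "nat \<Rightarrow> nat"
    and f :: "real^'n \<Rightarrow> real^'n"
    and \<alpha> :: real
    and c :: "nat \<Rightarrow> real"
    and L :: "nat \<Rightarrow> real mat"
    and lam :: "nat \<Rightarrow> real list"
  assumes "m \<ge> 1"
    and "\<forall>k<m. I k \<ge> 1"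
    and "continuous_on UNIV f"
    and "\<forall>x y. inner (x - y) (f x - f y) \<le> \<alpha> * inner (x - y) (x - y)"
    and "\<forall>k<m. c k \<ge> 0"
    and "\<forall>k<m. L k \<in> carrier_mat (I k) (I k)"
    and "\<forall>k<m. transpose_mat (L k) = L k"
    and "\<forall>k<m. \<forall>i<I k. \<forall>j<I k. i \<noteq> j \<longrightarrow> L k $$ (i, j) \<ge> 0"
    and "\<forall>k<m. \<forall>i<I k. (\<Sum>j<I k. L k $$ (i, j)) = 0"
    and "\<forall>k<m. eigenvalues_decreasing (L k) (lam k) \<and> lam k ! 0 = 0"
    \<comment> \<open>The second eigenvalue is \<open>lam k ! 1\<close>; a layer with \<open>I k = 1\<close> has none.\<close>
    and "\<forall>k<m. I k \<ge> 2 \<longrightarrow> c k * (lam k ! 1) + \<alpha> < 0"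
  shows "realizes_complete_synchronization m I f c L"
proof -
  define a where "a k i j = c k * L k $$ (i, j)" for k i j
  \<comment> \<open>One bound \<mu> serves all layers. The extra element is nonpositive and has a
    negative sum with \<alpha>; it keeps \<open>M\<close> nonempty when no layer has a second
    eigenvalue.\<close>
  define M where "M = insert (- \<bar>\<alpha>\<bar> - 1) ((\<lambda>k. c k * lam k ! 1) ` {k. k < m \<and> I k \<ge> 2})"
  define \<mu> where "\<mu> = Max M"
  have M: "finite M" "M \<noteq> {}" by (auto simp: M_def)
  have sym: "a k i j = a k j i" if "k < m" "i < I k" "j < I k" for k i j
    using assms(6,7) that symmetric_mat_index[of "L k" "I k" i j] by (simp add: a_def)
  have row: "(\<Sum>j<I k. a k i j) = 0" if "k < m" "i < I k" for k i
    using assms that by (simp add: a_def sum_distrib_left[symmetric])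
  have second: "lam k ! 1 \<le> 0"
    and quad: "(\<Sum>i<I k. v i) = 0 \<Longrightarrow>
      quad_form (I k) (\<lambda>i j. L k $$ (i, j)) v \<le> lam k ! 1 * (\<Sum>i<I k. (v i)\<^sup>2)"
    if "k < m" "I k \<ge> 2" for k v
    using quad_form_le_second_eigenvalue[of "L k" "I k" "lam k"] assms(6,7,9,10) that by auto
  \<comment> \<open>A nonnegative \<open>c k\<close> times a nonpositive second eigenvalue is
    nonpositive, which supplies the sign of \<mu> that \<open>network_dissipative\<close>
    requires.\<close>
  have "\<forall>e\<in>M. e \<le> 0 \<and> \<alpha> + e < 0"
    using second assms(5,11) by (auto simp: M_def mult_nonneg_nonpos add.commute)
  then have \<mu>: "\<mu> \<le> 0" "\<alpha> + \<mu> < 0" using Max_in[OF M] by (auto simp: \<mu>_def)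
  have bound: "quad_form (I k) (a k) v \<le> \<mu> * (\<Sum>i<I k. (v i)\<^sup>2)"
    if k: "k < m" and v: "(\<Sum>i<I k. v i) = 0" for k v
  proof (cases "I k \<ge> 2")
    case True
    have "quad_form (I k) (a k) v = c k * quad_form (I k) (\<lambda>i j. L k $$ (i, j)) v"
      by (simp add: quad_form_def a_def sum_distrib_left mult_ac)
    also have "\<dots> \<le> c k * (lam k ! 1 * (\<Sum>i<I k. (v i)\<^sup>2))"
      using quad[OF k True v] assms(5) k by (intro mult_left_mono) auto
    also have "\<dots> = (c k * lam k ! 1) * (\<Sum>i<I k. (v i)\<^sup>2)" by simp
    also have "\<dots> \<le> \<mu> * (\<Sum>i<I k. (v i)\<^sup>2)"
      unfolding \<mu>_def using k True M by (intro mult_right_mono Max_ge sum_nonneg) (auto simp: M_def)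
    finally show ?thesis .
  next
    case False
    \<comment> \<open>In a layer with a single index the only centred vector is zero, so both sides
      vanish.\<close>
    then have "I k = 1" using assms(2) k by force
    with v show ?thesis by (simp add: quad_form_def)
  qed
  show ?thesis
    unfolding realizes_complete_synchronization_def
  proof (intro allI impI ballI)
    fix x i j
    assume sol: "network_solution m I f c L x" and ij: "i \<in> nodes m I" "j \<in> nodes m I"
    define F where "F t i = f (x i t) + (\<Sum>k<m. layer_coupling I k (a k) (\<lambda>i. x i t) i)" for t i
    define W where "W t = (\<Sum>i\<in>nodes m I. \<Sum>j\<in>nodes m I. (norm (x i t - x j t))\<^sup>2)" for t
    define D where
      "D t = (\<Sum>i\<in>nodes m I. \<Sum>j\<in>nodes m I. 2 * inner (x i t - x j t) (F t i - F t j))" for t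
    have x': "(x i has_vector_derivative F t i) (at t within {0..})"
      if "i \<in> nodes m I" "t \<ge> 0" for i t
      using sol that by (simp add: network_solution_def F_def layer_coupling_def a_def scaleR_sum_right)
    have "(W \<longlongrightarrow> 0) at_top"
    proof (rule exponential_decay)
      fix t :: real assume t: "t \<ge> 0"
      show "(W has_real_derivative D t) (at t within {0..})"
        unfolding W_def D_def
        by (intro DERIV_sum has_real_derivative_norm_sq has_vector_derivative_diff x' t)
      have "D t = 2 * (\<Sum>i\<in>nodes m I. \<Sum>j\<in>nodes m I. inner (x i t - x j t) (F t i - F t j))"
        by (simp add: D_def sum_distrib_left)
      also have "\<dots> \<le> 2 * ((\<alpha> + \<mu>) * W t)"
        unfolding W_def using assms(2,4) sym row bound \<mu>(1)
        by (intro mult_left_mono network_dissipative[where f = f and a = a]) (auto simp: F_def)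
      finally show "D t \<le> - (- 2 * (\<alpha> + \<mu>)) * W t" by (simp add: algebra_simps)
    next
      show "- 2 * (\<alpha> + \<mu>) > 0" using \<mu>(2) by simp
      show "W t \<ge> 0" for t unfolding W_def by (intro sum_nonneg) simp
    qed
    then have W0: "((\<lambda>t. sqrt (W t)) \<longlongrightarrow> 0) at_top"
      using tendsto_real_sqrt by fastforce
    have "norm (x i t - x j t) \<le> sqrt (W t)" for t
    proof (rule real_le_rsqrt)
      have "(norm (x i t - x j t))\<^sup>2 \<le> (\<Sum>j\<in>nodes m I. (norm (x i t - x j t))\<^sup>2)"
        using ij by (intro member_le_sum finite_nodes) auto
      also have "\<dots> \<le> W t"
        unfolding W_def using ij(1)
        by (intro member_le_sum[where f = "\<lambda>i. \<Sum>j\<in>nodes m I. (norm (x i t - x j t))\<^sup>2"]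
            finite_nodes sum_nonneg) auto
      finally show "(norm (x i t - x j t))\<^sup>2 \<le> W t" .
    qed
    then show "((\<lambda>t. norm (x i t - x j t)) \<longlongrightarrow> 0) at_top"
      by (intro tendsto_sandwich[OF _ _ tendsto_const W0]) auto
  qed
qed

end
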